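(* Let $p,q\ge1$, $n=p+q$, let $Q=(j_1,\ldots,j_N)$ be a word in $\{1,\ldots,n-1\}$, $J$ a subword of $Q$, and $uB$ a $T$-fixed point of $Y_{+\cdots+-\cdots-}$. The point $\Phi(p_{(uB,J)})$ is a vertex of $\mathcal{P}_{Y_{+\cdots+-\cdots-},Q}$ if and only if $\Phi(p_{(B,J)})$ is a vertex of $\mathcal{P}_{Y_{+\cdots+-\cdots-},Q}$.
   Context: Setting: $G=GL_n(\mathbb C)$, $n=p+q$, $K=GL_p\times GL_q$ embedded block-diagonally, $B$ the upper triangular Borel subgroup, $T$ the diagonal torus; the Weyl group is $\mathfrak S_n$, $s_i=(i\ i+1)$, $P_i=B\cup Bs_iB$. $G/B$ is the variety of complete flags in $\mathbb C^n$. $Y_{+\cdots+-\cdots-}$ ($p$ pluses followed by $q$ minuses) is the closed $K$-orbit of flags $F_1\subset\cdots\subset F_{n-1}$ with $F_p=\langle e_1,\ldots,e_p\rangle$. For a closed $K$-orbit $Y_0$, $\mathcal{BEM}^{Y_0,Q}$ is the set of $(x_{N+1},\ldots,x_1)\in Y_0\times(G/B)^N$ such that $x_{i+1}$ and $x_i$ have the same image in $G/P_{j_i}$ (the two flags agree except possibly in dimension $j_i$) for all $i$. A subword $J=(\beta_1,\ldots,\beta_N)$ of $Q$ has $\beta_i\in\{-,j_i\}$; $s_-:=\mathrm{id}$; $p_{(uB,J)}:=(uB,us_{\beta_N}B,\ldots,us_{\beta_N}\cdots s_{\beta_1}B)$, a $T$-fixed point. Moment map: letting $F_1,\ldots,F_{n-1}$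 be the subspaces of $x_{N+1}$ and $V_k$ the $j_k$-dimensional subspace of $x_k$, $\mathcal{BEM}^{Y_0,Q}$ embeds in $\prod_{i=1}^{n-1}Gr(i,n)\times\prod_kGr(j_k,n)$. Each $Gr(d,n)$ is identified with the coadjoint orbit of the fundamental weight $\omega_d=e_1+\cdots+e_d$ of $U(n)$, with $T$-moment map sending $V$ to the diagonal (in $\mathbb R^n$) of the orthogonal projection matrix onto $V$. $\Phi$ is the sum of these over all $F_i$ and $V_k$; thus $\Phi(p_{(uB,J)})=u\big(\sum_{i=1}^{n-1}\omega_i+\sum_{i=1}^N s_{\beta_N}\cdots s_{\beta_i}\omega_{j_i}\big)$. The BEM polytope is $\mathcal{P}_{Y_0,Q}:=\Phi(\mathcal{BEM}^{Y_0,Q})\subset\mathbb R^n$, a convex polytope. *)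

theory Defs
  imports "HOL-Analysis.Analysis"
begin

text \<open>
  The ambient space is \<open>complex ^ 'n\<close> with \<open>n = CARD('n)\<close>.  Its coordinates are listed as
  \<open>1, \<dots>, n\<close> along the linear order of \<open>'n\<close>, so that Weyl group elements, words
  and dimensions of subspaces can all be expressed with natural numbers.
\<close>

definition coord :: "nat \<Rightarrow> 'n::{finite,linorder}" where
  "coord k = sorted_list_of_set (UNIV :: 'n set) ! (k - 1)"

definition basis_vec :: "nat \<Rightarrow> complex ^ 'n::{finite,linorder}" where
  "basis_vec k = axis (coord k) 1"


subsection \<open>Complete flags\<close>

text \<open>
  A flag is the family of all its subspaces, indexed by dimension.  Indices above \<open>n\<close> are
  pinned to the whole space, so equality of such families is equality of flags; the subspaces
  for \<open>0\<close> and \<open>n\<close> are forced.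
\<close>

type_synonym 'n flag = "nat \<Rightarrow> (complex ^ 'n) set"

definition complete_flags :: "'n::{finite,linorder} flag set" where
  "complete_flags = {F. (\<forall>i. vec.subspace (F i) \<and> vec.dim (F i) = min i CARD('n)) \<and>
                        (\<forall>i. F i \<subseteq> F (Suc i))}"

text \<open>
  The point \<open>uB\<close> of \<open>G/B\<close>: the stabiliser \<open>B\<close> of the standard flag consists of the
  upper triangular matrices, and the permutation matrix of \<open>u\<close> maps \<open>e\<^sub>k\<close> to
  \<open>e\<^bsub>u(k)\<^esub>\<close>.
\<close>

definition perm_flag :: "(nat \<Rightarrow> nat) \<Rightarrow> 'n::{finite,linorder} flag" where
  "perm_flag u = (\<lambda>i. vec.span {basis_vec (u k) | k. 1 \<le> k \<and> k \<le> min i CARD('n)})"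

definition torus :: "(complex ^ 'n::finite ^ 'n) set" where
  "torus = {t. (\<forall>a. t $ a $ a \<noteq> 0) \<and> (\<forall>a b. a \<noteq> b \<longrightarrow> t $ a $ b = 0)}"

definition flag_act :: "complex ^ 'n::finite ^ 'n \<Rightarrow> 'n flag \<Rightarrow> 'n flag" where
  "flag_act g F = (\<lambda>i. (\<lambda>v. g *v v) ` F i)"

definition T_fixed :: "'n::finite flag set \<Rightarrow> 'n flag set" where
  "T_fixed Y = {F \<in> Y. \<forall>t\<in>torus. flag_act t F = F}"

text \<open>The closed orbit \<open>Y\<^bsub>+\<cdots>+-\<cdots>-\<^esub>\<close> with \<open>p\<close> pluses followed by \<open>n - p\<close> minuses.\<close>

definition plus_minus_orbit :: "nat \<Rightarrow> 'n::{finite,linorder} flag set" where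
  "plus_minus_orbit p = {F \<in> complete_flags. F p = vec.span (basis_vec ` {1..p})}"


subsection \<open>BEM varieties and their distinguished points\<close>

text \<open>
  A word \<open>(j\<^sub>1, \<dots>, j\<^sub>N)\<close> is a list whose entry at position \<open>i - 1\<close> is \<open>j\<^sub>i\<close>; in a subword,
  \<open>None\<close> stands for the letter \<open>-\<close>.
\<close>

definition is_word :: "nat \<Rightarrow> nat list \<Rightarrow> bool" where
  "is_word n Q \<longleftrightarrow> set Q \<subseteq> {1..n - 1}"

definition subword :: "nat option list \<Rightarrow> nat list \<Rightarrow> bool" where
  "subword J Q \<longleftrightarrow> list_all2 (\<lambda>\<beta> j. \<beta> = None \<or> \<beta> = Some j) J Q"

text \<open>Equality of the images of two flags in \<open>G/P\<^sub>j\<close>.\<close>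

definition same_mod_P :: "nat \<Rightarrow> 'n flag \<Rightarrow> 'n flag \<Rightarrow> bool" where
  "same_mod_P j F F' \<longleftrightarrow> (\<forall>i. i \<noteq> j \<longrightarrow> F i = F' i)"

text \<open>
  The tuple \<open>(x\<^bsub>N+1\<^esub>, \<dots>, x\<^sub>1)\<close> is the extensional function \<open>x\<close> on \<open>{1..N + 1}\<close>.
\<close>

definition BEM :: "'n::{finite,linorder} flag set \<Rightarrow> nat list \<Rightarrow> (nat \<Rightarrow> 'n flag) set" where
  "BEM Y\<^sub>0 Q = {x \<in> {1..length Q + 1} \<rightarrow>\<^sub>E complete_flags.
                 x (length Q + 1) \<in> Y\<^sub>0 \<and>
                 (\<forall>i\<in>{1..length Q}. same_mod_P (Q ! (i - 1)) (x (i + 1)) (x i))}"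

fun letter_perm :: "nat option \<Rightarrow> nat \<Rightarrow> nat" where
  "letter_perm None = id"
| "letter_perm (Some j) = Transposition.transpose j (j + 1)"

text \<open>The product \<open>s\<^bsub>\<beta>\<^sub>N\<^esub> \<cdots> s\<^bsub>\<beta>\<^sub>i\<^esub>\<close>; it is the identity for \<open>i = N + 1\<close>.\<close>

definition tail_perm :: "nat option list \<Rightarrow> nat \<Rightarrow> nat \<Rightarrow> nat" where
  "tail_perm J i = fold (\<lambda>\<beta> w. letter_perm \<beta> \<circ> w) (drop (i - 1) J) id"

definition bem_point :: "(nat \<Rightarrow> nat) \<Rightarrow> nat option list \<Rightarrow> nat \<Rightarrow> 'n::{finite,linorder} flag" where
  "bem_point u J = (\<lambda>i\<in>{1..length J + 1}. perm_flag (u \<circ> tail_perm J i))"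


subsection \<open>Moment map and polytope\<close>

definition hermitian_inner :: "complex ^ 'n::finite \<Rightarrow> complex ^ 'n \<Rightarrow> complex" where
  "hermitian_inner v w = (\<Sum>a\<in>UNIV. v $ a * cnj (w $ a))"

definition proj_matrix :: "(complex ^ 'n::finite) set \<Rightarrow> complex ^ 'n ^ 'n" where
  "proj_matrix V = (THE P. \<forall>v. P *v v \<in> V \<and> (\<forall>w\<in>V. hermitian_inner (v - P *v v) w = 0))"

text \<open>
  An orthogonal projection matrix is Hermitian, so taking real parts loses nothing.
\<close>

definition gr_moment :: "(complex ^ 'n::finite) set \<Rightarrow> real ^ 'n" where
  "gr_moment V = (\<chi> a. Re (proj_matrix V $ a $ a))"

definition moment_map :: "nat list \<Rightarrow> (nat \<Rightarrow> 'n::{finite,linorder} flag) \<Rightarrow> real ^ 'n::{finite,linorder}" where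
  "moment_map Q x = (\<Sum>i = 1..CARD('n) - 1. gr_moment (x (length Q + 1) i)) +
                    (\<Sum>k = 1..length Q. gr_moment (x k (Q ! (k - 1))))"

definition bem_polytope :: "'n::{finite,linorder} flag set \<Rightarrow> nat list \<Rightarrow> (real ^ 'n::{finite,linorder}) set" where
  "bem_polytope Y\<^sub>0 Q = moment_map Q ` BEM Y\<^sub>0 Q"

end

theory Submission
  imports Defs
begin

text \<open>
  The Weyl group does not act on the BEM variety, but the permutations that fix the subspace
  \<open>\<langle>e\<^sub>1, \<dots>, e\<^sub>p\<rangle>\<close> do: their permutation matrices lie in \<open>K\<close>, so they map the orbit \<open>Y\<close> to
  itself, and the relation of agreeing outside one dimension is invariant under all of \<open>GL\<^sub>n\<close>
  (\<open>permute_plus_minus_orbit\<close>, \<open>permute_tuple_BEM\<close>).  That \<open>uB\<close> lies in \<open>Y\<close> says exactly that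
  \<open>u\<close> is such a permutation.

  A permutation matrix is also unitary, so it conjugates the orthogonal projection onto \<open>V\<close> into
  the one onto the image of \<open>V\<close>, which permutes the diagonal entries.  Hence the moment map is
  equivariant (\<open>gr_moment_permute_coords\<close>, \<open>moment_map_permute_tuple\<close>), and the permutation of
  the coordinates of \<open>\<real>\<^sup>n\<close> is a linear automorphism of the polytope
  (\<open>bem_polytope_permute_eq\<close>).  It carries the image of \<open>p\<^bsub>(B,J)\<^esub>\<close> to that of \<open>p\<^bsub>(uB,J)\<^esub>\<close>
  (\<open>permute_perm_flag\<close>), and a linear automorphism preserves extreme points.
\<close>

section \<open>Permuting coordinates\<close>

text \<open>
  The inverse makes this the permutation matrix of \<open>\<sigma>\<close>, sending \<open>e\<^sub>a\<close> to \<open>e\<^bsub>\<sigma>(a)\<^esub>\<close>.  It acts on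
  \<open>\<complex>\<^sup>n\<close>, where the flags live, and on \<open>\<real>\<^sup>n\<close>, where the moment map takes its values.
\<close>
definition permute_coords :: "('n \<Rightarrow> 'n) \<Rightarrow> 'a ^ 'n \<Rightarrow> 'a ^ 'n" where
  "permute_coords \<sigma> v = (\<chi> a. v $ inv \<sigma> a)"

lemma permute_coords_inv:
  assumes "bij \<sigma>"
  shows "permute_coords \<sigma> (permute_coords (inv \<sigma>) v) = v"
    and "permute_coords (inv \<sigma>) (permute_coords \<sigma> v) = v"
  using assms
  by (simp_all add: permute_coords_def vec_eq_iff inv_inv_eq bij_is_inj bij_is_surj surj_f_inv_f)

lemma inj_permute_coords: "bij \<sigma> \<Longrightarrow> inj (permute_coords \<sigma>)"
  by (metis injI permute_coords_inv(2))

lemma permute_coords_axis: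
  assumes "bij \<sigma>"
  shows "permute_coords \<sigma> (axis a c) = axis (\<sigma> a) c"
  using assms
  by (auto simp: permute_coords_def vec_eq_iff axis_def bij_is_inj bij_is_surj surj_f_inv_f)

lemma linear_permute_coords: "Vector_Spaces.linear (*s) (*s) (permute_coords \<sigma> :: 'a::field ^ 'n \<Rightarrow> _)"
  by unfold_locales (simp_all add: permute_coords_def vec_eq_iff algebra_simps)

lemma vec_subspace_permute_coords:
  fixes V :: "('a::field ^ 'n) set"
  assumes "vec.subspace V"
  shows "vec.subspace (permute_coords \<sigma> ` V)"
  by (metis assms vec.linear_span_image[OF linear_permute_coords] vec.span_eq_iff)

lemma real_linear_permute_coords: "linear (permute_coords \<sigma> :: 'a::real_vector ^ 'n \<Rightarrow> _)"
  by (rule linearI) (simp_all add: permute_coords_def vec_eq_iff)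

lemma sum_inv_reindex:
  fixes \<sigma> :: "'n::finite \<Rightarrow> 'n"
  assumes "bij \<sigma>"
  shows "(\<Sum>a\<in>UNIV. f (inv \<sigma> a)) = (\<Sum>a\<in>UNIV. f a)"
  using assms by (intro sum.reindex_bij_betw) (simp add: bij_imp_bij_inv)

text \<open>Permutation matrices are unitary.\<close>
lemma hermitian_inner_permute_coords:
  assumes "bij \<sigma>"
  shows "hermitian_inner (permute_coords \<sigma> v) (permute_coords \<sigma> w) = hermitian_inner v w"
  unfolding hermitian_inner_def permute_coords_def
  using sum_inv_reindex[OF assms, of "\<lambda>a. v $ a * cnj (w $ a)"] by simp

section \<open>Orthogonal projections onto complex subspaces\<close>

text \<open>
  The matrix \<open>proj_matrix V\<close> is defined by a definite description, which says nothing before this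
  property is known to have exactly one solution.
\<close>
definition is_orth_proj :: "(complex ^ 'n::finite) set \<Rightarrow> complex ^ 'n ^ 'n \<Rightarrow> bool" where
  "is_orth_proj V P \<longleftrightarrow> (\<forall>v. P *v v \<in> V \<and> (\<forall>w\<in>V. hermitian_inner (v - P *v v) w = 0))"

lemma Re_hermitian_inner: "Re (hermitian_inner v w) = v \<bullet> w"
  by (simp add: hermitian_inner_def inner_vec_def inner_complex_def)

lemma hermitian_inner_diff: "hermitian_inner (u - v) w = hermitian_inner u w - hermitian_inner v w"
  by (simp add: hermitian_inner_def algebra_simps sum_subtractf)

lemma hermitian_inner_add: "hermitian_inner (u + v) w = hermitian_inner u w + hermitian_inner v w"
  by (simp add: hermitian_inner_def algebra_simps sum.distrib)

lemma hermitian_inner_scale: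
  "hermitian_inner (c *s v) w = c * hermitian_inner v w"
  "hermitian_inner v (c *s w) = cnj c * hermitian_inner v w"
  by (simp_all add: hermitian_inner_def algebra_simps sum_distrib_left)

text \<open>
  The difference of two candidates lies in \<open>V\<close> and is orthogonal to \<open>V\<close>, hence to itself.
\<close>
lemma orth_component_unique:
  assumes V: "vec.subspace V" and "x \<in> V" "y \<in> V"
    and "\<forall>w\<in>V. hermitian_inner (v - x) w = 0" "\<forall>w\<in>V. hermitian_inner (v - y) w = 0"
  shows "x = y"
proof -
  have "x - y \<in> V" using assms vec.subspace_diff by blast
  then have "hermitian_inner (v - y) (x - y) - hermitian_inner (v - x) (x - y) = 0"
    using assms by simp
  then have "hermitian_inner (x - y) (x - y) = 0"
    by (simp add: hermitian_inner_diff)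
  then have "(x - y) \<bullet> (x - y) = 0"
    by (metis Re_hermitian_inner zero_complex.simps(1))
  then show ?thesis by simp
qed

text \<open>
  Decompose \<open>v\<close> orthogonally for the real inner product, which is the real part of the Hermitian
  one.  As \<open>V\<close> is stable under multiplication by \<open>\<i>\<close>, real orthogonality to both \<open>w\<close> and \<open>\<i> w\<close>
  makes the real and the imaginary part of the Hermitian product with \<open>w\<close> vanish.
\<close>
lemma orth_component_exists:
  fixes V :: "(complex ^ 'n::finite) set"
  assumes V: "vec.subspace V"
  shows "\<exists>y\<in>V. \<forall>w\<in>V. hermitian_inner (v - y) w = 0"
proof -
  have scaleR: "r *\<^sub>R x = complex_of_real r *s x" for r and x :: "complex ^ 'n"
    by (simp add: vec_eq_iff scaleR_conv_of_real[where 'a = complex])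
  have sub: "subspace V"
    using V by (auto simp: subspace_def vec.subspace_def scaleR)
  obtain y z where y: "y \<in> span V" and z: "\<And>w. w \<in> span V \<Longrightarrow> orthogonal z w" and "v = y + z"
    using orthogonal_subspace_decomp_exists by metis
  have "hermitian_inner (v - y) w = 0" if "w \<in> V" for w
  proof -
    have "\<i> *s w \<in> V" using V that vec.subspace_scale by blast
    then have "z \<bullet> w = 0" "z \<bullet> (\<i> *s w) = 0"
      using z that by (auto simp: orthogonal_def span_base)
    then have "Re (hermitian_inner z w) = 0" "Re (- \<i> * hermitian_inner z w) = 0"
      by (simp_all only: Re_hermitian_inner[symmetric] hermitian_inner_scale) simp_all
    then show ?thesis using \<open>v = y + z\<close> by (simp add: complex_eq_iff)
  qed
  moreover have "y \<in> V" using y sub by (metis span_eq_iff)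
  ultimately show ?thesis by blast
qed

text \<open>Uniqueness of the component in \<open>V\<close> forces it to depend linearly on the vector.\<close>
lemma is_orth_proj_exists:
  fixes V :: "(complex ^ 'n::finite) set"
  assumes V: "vec.subspace V"
  shows "\<exists>P. is_orth_proj V P"
proof -
  obtain f where f: "\<And>v. f v \<in> V" "\<And>v w. w \<in> V \<Longrightarrow> hermitian_inner (v - f v) w = 0"
    using orth_component_exists[OF V] by metis
  have eq: "f v = y" if "y \<in> V" "\<And>w. w \<in> V \<Longrightarrow> hermitian_inner (v - y) w = 0" for v y
    by (rule orth_component_unique[OF V, of _ _ v]) (use f that in auto)
  have "f (v + w) = f v + f w" for v w
  proof (rule eq)
    show "f v + f w \<in> V" using V f vec.subspace_add by blast
    fix x assume x: "x \<in> V"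
    have "v + w - (f v + f w) = (v - f v) + (w - f w)" by simp
    then show "hermitian_inner (v + w - (f v + f w)) x = 0"
      using f(2)[OF x] by (simp only: hermitian_inner_add) simp
  qed
  moreover have "f (c *s v) = c *s f v" for c v
  proof (rule eq)
    show "c *s f v \<in> V" using V f vec.subspace_scale by blast
    fix x assume x: "x \<in> V"
    have "c *s v - c *s f v = c *s (v - f v)" by (simp add: vec_eq_iff algebra_simps)
    then show "hermitian_inner (c *s v - c *s f v) x = 0"
      using f(2)[OF x] by (simp only: hermitian_inner_scale) simp
  qed
  ultimately have "Vector_Spaces.linear (*s) (*s) f"
    by unfold_locales (simp_all add: vector_add_ldistrib vector_sadd_rdistrib vector_smult_assoc)
  then have "matrix f *v v = f v" for v by (rule matrix_works)
  then show ?thesis unfolding is_orth_proj_def using f by metis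
qed

lemma proj_matrix_eqI:
  assumes V: "vec.subspace V" and P: "is_orth_proj V P"
  shows "proj_matrix V = P"
  unfolding proj_matrix_def is_orth_proj_def[symmetric]
proof (rule the_equality)
  show "is_orth_proj V P" by (rule P)
next
  fix P' assume P': "is_orth_proj V P'"
  have "P' *v v = P *v v" for v
    by (rule orth_component_unique[OF V, of _ _ v]) (use P P' in \<open>auto simp: is_orth_proj_def\<close>)
  then show "P' = P" by (simp add: matrix_eq)
qed

section \<open>Equivariance of the moment map\<close>

text \<open>
  The right-hand side is the conjugate of the projection onto \<open>V\<close> by the permutation matrix of
  \<open>\<sigma>\<close>; it is the projection onto the image of \<open>V\<close> because that matrix is unitary.
\<close>
lemma proj_matrix_permute_coords:
  fixes V :: "(complex ^ 'n::finite) set"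
  assumes V: "vec.subspace V" and \<sigma>: "bij \<sigma>"
  shows "proj_matrix (permute_coords \<sigma> ` V) = (\<chi> a b. proj_matrix V $ inv \<sigma> a $ inv \<sigma> b)"
    (is "_ = ?M")
proof (rule proj_matrix_eqI)
  show "vec.subspace (permute_coords \<sigma> ` V)"
    by (rule vec_subspace_permute_coords[OF V])
next
  obtain P where P: "is_orth_proj V P" using is_orth_proj_exists[OF V] by blast
  with V have PV: "proj_matrix V = P" by (rule proj_matrix_eqI)
  have M: "?M *v permute_coords \<sigma> v = permute_coords \<sigma> (P *v v)" for v
    using sum_inv_reindex[OF \<sigma>, of "\<lambda>b. P $ _ $ b * v $ b"]
    by (simp add: PV vec_eq_iff matrix_vector_mult_def permute_coords_def)
  show "is_orth_proj (permute_coords \<sigma> ` V) ?M"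
    unfolding is_orth_proj_def
  proof (intro allI conjI)
    fix v :: "complex ^ 'n"
    obtain v' where v: "v = permute_coords \<sigma> v'" by (metis \<sigma> permute_coords_inv(1))
    show "?M *v v \<in> permute_coords \<sigma> ` V"
      unfolding v M using P by (simp add: is_orth_proj_def)
    have "v - ?M *v v = permute_coords \<sigma> (v' - P *v v')"
      unfolding v M by (simp add: linear_diff[OF real_linear_permute_coords])
    then show "\<forall>w\<in>permute_coords \<sigma> ` V. hermitian_inner (v - ?M *v v) w = 0"
      using P by (simp add: hermitian_inner_permute_coords[OF \<sigma>] is_orth_proj_def)
  qed
qed

lemma gr_moment_permute_coords:
  assumes "vec.subspace V" "bij \<sigma>"
  shows "gr_moment (permute_coords \<sigma> ` V) = permute_coords \<sigma> (gr_moment V)"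
  unfolding gr_moment_def proj_matrix_permute_coords[OF assms] by (simp add: permute_coords_def)

definition permute_flag :: "('n::finite \<Rightarrow> 'n) \<Rightarrow> 'n flag \<Rightarrow> 'n flag" where
  "permute_flag \<sigma> F = (\<lambda>i. permute_coords \<sigma> ` F i)"

lemma permute_flag_inv:
  assumes "bij \<sigma>"
  shows "permute_flag \<sigma> (permute_flag (inv \<sigma>) F) = F"
  using assms by (simp add: permute_flag_def image_image permute_coords_inv)

lemma permute_flag_complete:
  fixes F :: "'n::{finite,linorder} flag"
  assumes "bij \<sigma>" "F \<in> complete_flags"
  shows "permute_flag \<sigma> F \<in> complete_flags"
proof -
  have "inj (permute_coords \<sigma> :: complex ^ 'n::{finite,linorder} \<Rightarrow> _)"
    using assms by (simp add: inj_permute_coords)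
  then have "vec.dim (permute_coords \<sigma> ` F i) = vec.dim (F i)" for i
    by (intro vec.dim_image_eq linear_permute_coords) (blast intro: inj_on_subset)
  moreover have "vec.subspace (permute_coords \<sigma> ` F i)" for i
    using assms by (intro vec_subspace_permute_coords) (simp add: complete_flags_def)
  moreover have "permute_coords \<sigma> ` F i \<subseteq> permute_coords \<sigma> ` F (Suc i)" for i
    using assms by (intro image_mono) (simp add: complete_flags_def)
  ultimately show ?thesis
    using assms by (simp add: complete_flags_def permute_flag_def)
qed

definition permute_tuple :: "nat \<Rightarrow> ('n::finite \<Rightarrow> 'n) \<Rightarrow> (nat \<Rightarrow> 'n flag) \<Rightarrow> nat \<Rightarrow> 'n flag" where
  "permute_tuple N \<sigma> x = (\<lambda>i\<in>{1..N + 1}. permute_flag \<sigma> (x i))"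

text \<open>
  Acting on all flags of a tuple at once preserves the condition on neighbouring flags, so only the
  flag in \<open>Y\<close> restricts the permutations that act on the variety.
\<close>
lemma permute_tuple_BEM:
  fixes x :: "nat \<Rightarrow> 'n::{finite,linorder} flag"
  assumes "bij \<sigma>" "x \<in> BEM Y Q" "permute_flag \<sigma> ` Y \<subseteq> Y"
  shows "permute_tuple (length Q) \<sigma> x \<in> BEM Y Q"
proof -
  have "permute_flag \<sigma> (x i) \<in> complete_flags" if "i \<in> {1..length Q + 1}" for i
    using assms that by (intro permute_flag_complete) (auto simp: BEM_def)
  moreover have "permute_flag \<sigma> (x (length Q + 1)) \<in> Y"
    using assms by (auto simp: BEM_def)
  moreover have "same_mod_P (Q ! (i - 1)) (permute_flag \<sigma> (x (i + 1))) (permute_flag \<sigma> (x i))"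
    if "i \<in> {1..length Q}" for i
    using assms that by (simp add: BEM_def same_mod_P_def permute_flag_def)
  ultimately show ?thesis
    by (auto simp: BEM_def permute_tuple_def)
qed

text \<open>
  The moment map is a sum of moment maps of Grassmannians, each of them equivariant.  Stated for
  tuples of families of subspaces, this serves both for the points of the variety and for the
  distinguished points themselves.
\<close>
lemma moment_map_permute_tuple:
  fixes x :: "nat \<Rightarrow> 'n::{finite,linorder} flag"
  assumes \<sigma>: "bij \<sigma>" and x: "\<And>i d. i \<in> {1..length Q + 1} \<Longrightarrow> vec.subspace (x i d)"
  shows "moment_map Q (permute_tuple (length Q) \<sigma> x) = permute_coords \<sigma> (moment_map Q x)"
proof -
  have eq: "gr_moment (permute_tuple (length Q) \<sigma> x i d) = permute_coords \<sigma> (gr_moment (x i d))"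
    if "i \<in> {1..length Q + 1}" for i d
    using gr_moment_permute_coords[OF x[OF that] \<sigma>] that
    by (simp add: permute_tuple_def permute_flag_def)
  show ?thesis
    by (simp add: moment_map_def eq linear_add[OF real_linear_permute_coords]
        linear_sum[OF real_linear_permute_coords])
qed

lemma bem_polytope_permute_subset:
  assumes "bij \<sigma>" "permute_flag \<sigma> ` Y \<subseteq> Y"
  shows "permute_coords \<sigma> ` bem_polytope Y Q \<subseteq> bem_polytope Y Q"
proof -
  have "permute_coords \<sigma> (moment_map Q x) \<in> moment_map Q ` BEM Y Q" if "x \<in> BEM Y Q" for x
  proof -
    have "vec.subspace (x i d)" if "i \<in> {1..length Q + 1}" for i d
      using \<open>x \<in> BEM Y Q\<close> that by (auto simp: BEM_def complete_flags_def PiE_iff)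
    then have "permute_coords \<sigma> (moment_map Q x) = moment_map Q (permute_tuple (length Q) \<sigma> x)"
      by (rule moment_map_permute_tuple[OF assms(1), symmetric])
    then show ?thesis using permute_tuple_BEM[OF assms(1) that assms(2)] by simp
  qed
  then show ?thesis by (auto simp: bem_polytope_def)
qed

text \<open>If \<open>\<sigma>\<close> preserves \<open>Y\<close>, so does its inverse; this gives the second inclusion.\<close>
lemma bem_polytope_permute_eq:
  assumes \<sigma>: "bij \<sigma>" and Y: "permute_flag \<sigma> ` Y = Y"
  shows "permute_coords \<sigma> ` bem_polytope Y Q = bem_polytope Y Q"
proof
  show "permute_coords \<sigma> ` bem_polytope Y Q \<subseteq> bem_polytope Y Q"
    using assms by (simp add: bem_polytope_permute_subset)
  have "permute_flag (inv \<sigma>) ` Y \<subseteq> Y"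
  proof -
    have "permute_flag (inv \<sigma>) (permute_flag \<sigma> F) = F" for F
      using permute_flag_inv[OF bij_imp_bij_inv[OF \<sigma>]] \<sigma> by (simp add: inv_inv_eq)
    then show ?thesis by (subst (1) Y[symmetric]) auto
  qed
  then have "permute_coords (inv \<sigma>) ` bem_polytope Y Q \<subseteq> bem_polytope Y Q"
    by (simp add: \<sigma> bem_polytope_permute_subset bij_imp_bij_inv)
  then show "bem_polytope Y Q \<subseteq> permute_coords \<sigma> ` bem_polytope Y Q"
    by (metis (no_types, lifting) \<sigma> image_eqI image_subset_iff permute_coords_inv(1) subsetI)
qed

section \<open>Weyl group elements acting on coordinate flags\<close>

lemma bij_betw_coord: "bij_betw (coord :: nat \<Rightarrow> 'n::{finite,linorder}) {1..CARD('n)} UNIV"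
proof -
  have "bij_betw ((!) (sorted_list_of_set (UNIV :: 'n set))) {..<CARD('n)} UNIV"
    by (rule bij_betw_nth) simp_all
  moreover have "bij_betw (\<lambda>k. k - 1) {1..CARD('n)} {..<CARD('n)}"
    by (rule bij_betw_byWitness[where f' = Suc]) auto
  ultimately have "bij_betw ((!) (sorted_list_of_set (UNIV :: 'n set)) \<circ> (\<lambda>k. k - 1)) {1..CARD('n)} UNIV"
    by (rule bij_betw_trans[rotated])
  then show ?thesis by (simp only: coord_def[abs_def] comp_def)
qed

text \<open>
  A Weyl group element permutes the numbers \<open>1, \<dots>, n\<close>; this transports it to the index type
  along the enumeration of the coordinates.
\<close>
lemma coord_permutation_exists:
  fixes u :: "nat \<Rightarrow> nat"
  assumes "u permutes {1..CARD('n)}"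
  obtains \<sigma> :: "'n::{finite,linorder} \<Rightarrow> 'n" where "bij \<sigma>"
    and "\<And>k. k \<in> {1..CARD('n)} \<Longrightarrow> \<sigma> (coord k) = coord (u k)"
proof
  let ?c = "coord :: nat \<Rightarrow> 'n" and ?I = "{1..CARD('n)}"
  let ?\<sigma> = "?c \<circ> u \<circ> inv_into ?I ?c"
  show "bij ?\<sigma>"
    using bij_betw_trans[OF bij_betw_inv_into[OF bij_betw_coord]
        bij_betw_trans[OF permutes_imp_bij[OF assms] bij_betw_coord]]
    by (simp add: comp_assoc)
  show "?\<sigma> (coord k) = coord (u k)" if "k \<in> ?I" for k
    using bij_betw_inv_into_left[OF bij_betw_coord that] by simp
qed

text \<open>
  The point \<open>wB\<close> is moved to \<open>uwB\<close>.  The values of \<open>w\<close> have to stay within \<open>1, \<dots>, n\<close>, since the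
  action is tied to \<open>u\<close> only on these numbers.
\<close>
lemma permute_perm_flag:
  fixes \<sigma> :: "'n::{finite,linorder} \<Rightarrow> 'n"
  assumes "bij \<sigma>" and u: "\<And>k. k \<in> {1..CARD('n)} \<Longrightarrow> \<sigma> (coord k) = coord (u k)"
    and w: "w ` {1..CARD('n)} \<subseteq> {1..CARD('n)}"
  shows "permute_flag \<sigma> (perm_flag w :: 'n flag) = perm_flag (u \<circ> w)"
proof
  fix i
  have eq: "permute_coords \<sigma> (basis_vec (w k)) = (basis_vec (u (w k)) :: complex ^ 'n::{finite,linorder})"
    if "1 \<le> k" "k \<le> CARD('n)" for k
    using w that u assms(1) by (simp add: basis_vec_def permute_coords_axis image_subset_iff)
  have "{basis_vec (u (w k)) | k. 1 \<le> k \<and> k \<le> min i CARD('n)} =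
        permute_coords \<sigma> ` {basis_vec (w k) | k. 1 \<le> k \<and> k \<le> min i CARD('n)}"
    using eq by (force simp: image_iff)
  then show "permute_flag \<sigma> (perm_flag w :: 'n flag) i = perm_flag (u \<circ> w) i"
    by (simp add: permute_flag_def perm_flag_def vec.linear_span_image[OF linear_permute_coords])
qed

lemma tail_perm_permutes:
  assumes "subword J Q" "is_word n Q"
  shows "tail_perm J i permutes {1..n}"
proof -
  have letter: "letter_perm \<beta> permutes {1..n}" if "\<beta> \<in> set J" for \<beta>
  proof (cases \<beta>)
    case None then show ?thesis by (simp add: permutes_id)
  next
    case (Some j)
    obtain k where "k < length J" "J ! k = Some j"
      using \<open>\<beta> \<in> set J\<close> Some by (metis in_set_conv_nth)
    then have "Q ! k = j" "k < length Q"
      using assms(1) by (auto simp: subword_def list_all2_conv_all_nth)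
    then have "j \<in> {1..n - 1}"
      using assms(2) by (metis is_word_def nth_mem subsetD)
    then show ?thesis unfolding Some letter_perm.simps by (intro permutes_swap_id) auto
  qed
  have "fold (\<lambda>\<beta> w. letter_perm \<beta> \<circ> w) bs w permutes {1..n}"
    if "set bs \<subseteq> set J" "w permutes {1..n}" for bs w
    using that
  proof (induction bs arbitrary: w)
    case (Cons \<beta> bs)
    then have step: "letter_perm \<beta> \<circ> w permutes {1..n}" by (intro permutes_compose letter) auto
    have "fold (\<lambda>\<beta> w. letter_perm \<beta> \<circ> w) bs (letter_perm \<beta> \<circ> w) permutes {1..n}"
      by (rule Cons.IH[OF _ step]) (use Cons.prems in simp)
    then show ?case by (simp only: fold_simps)
  qed simp
  then show ?thesis
    unfolding tail_perm_def by (simp add: permutes_id set_drop_subset)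
qed

text \<open>
  The orbit is cut out of the flags by its \<open>p\<close>-dimensional subspace, and a permutation that fixes
  this subspace has an inverse that fixes it too.
\<close>
lemma permute_plus_minus_orbit:
  fixes \<sigma> :: "'n::{finite,linorder} \<Rightarrow> 'n"
  assumes \<sigma>: "bij \<sigma>"
    and S: "permute_coords \<sigma> ` vec.span (basis_vec ` {1..p}) = vec.span (basis_vec ` {1..p})"
  shows "permute_flag \<sigma> ` plus_minus_orbit p = plus_minus_orbit p"
proof
  show "permute_flag \<sigma> ` plus_minus_orbit p \<subseteq> plus_minus_orbit p"
    using S permute_flag_complete[OF \<sigma>] by (auto simp: plus_minus_orbit_def permute_flag_def)
  have "permute_coords (inv \<sigma>) ` vec.span (basis_vec ` {1..p}) = vec.span (basis_vec ` {1..p})"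
    using arg_cong[OF S, of "image (permute_coords (inv \<sigma>))"] \<sigma>
    by (simp add: image_image permute_coords_inv)
  then have "permute_flag (inv \<sigma>) F \<in> plus_minus_orbit p" if "F \<in> plus_minus_orbit p" for F
    using that permute_flag_complete[OF bij_imp_bij_inv[OF \<sigma>]]
    by (auto simp: plus_minus_orbit_def permute_flag_def)
  then show "plus_minus_orbit p \<subseteq> permute_flag \<sigma> ` plus_minus_orbit p"
    by (metis \<sigma> image_eqI permute_flag_inv subsetI)
qed

section \<open>Vertices of the polytope\<close>

lemma extreme_point_of_linear_symmetry:
  fixes f :: "'a::real_vector \<Rightarrow> 'a"
  assumes "linear f" "inj f" "f ` S = S"
  shows "f x extreme_point_of S \<longleftrightarrow> x extreme_point_of S"
proof -
  have "f x extreme_point_of f ` S \<longleftrightarrow> x extreme_point_of S"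
    using assms(1,2)
    by (simp add: extreme_point_of_def open_segment_linear_image inj_image_mem_iff)
  then show ?thesis using assms by simp
qed

theorem corollary6p5:
  fixes p q :: nat
    and Q :: "nat list"
    and J :: "nat option list"
    and u :: "nat \<Rightarrow> nat"
    and Y :: "'n::{finite,linorder} flag set"
  assumes "p \<ge> 1" and "q \<ge> 1" and "CARD('n) = p + q"
    and "is_word (p + q) Q"
    and "subword J Q"
    and "u permutes {1..p + q}"
    and "Y = plus_minus_orbit p"
    and "perm_flag u \<in> T_fixed Y"
  shows "moment_map Q (bem_point u J :: nat \<Rightarrow> 'n flag) extreme_point_of bem_polytope Y Q \<longleftrightarrow>
         moment_map Q (bem_point id J :: nat \<Rightarrow> 'n flag) extreme_point_of bem_polytope Y Q"
proof -
  obtain \<sigma> :: "'n \<Rightarrow> 'n" where \<sigma>: "bij \<sigma>"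
    and u: "\<And>k. k \<in> {1..CARD('n)} \<Longrightarrow> \<sigma> (coord k) = coord (u k)"
    using coord_permutation_exists assms(3,6) by metis
  have std: "{basis_vec (id k) | k. 1 \<le> k \<and> k \<le> min p CARD('n)} = basis_vec ` {1..p}"
    using assms(3) by auto
  have "permute_coords \<sigma> ` vec.span (basis_vec ` {1..p}) =
      permute_flag \<sigma> (perm_flag id :: 'n flag) p"
    unfolding permute_flag_def perm_flag_def std ..
  also have "\<dots> = perm_flag u p"
    using permute_perm_flag[OF \<sigma> u, of id] by simp
  also have "\<dots> = vec.span (basis_vec ` {1..p})"
    using assms(7,8) by (simp add: T_fixed_def plus_minus_orbit_def)
  \<comment> \<open>Together: the permutation fixes the subspace that defines the orbit.\<close>
  finally have Y: "permute_flag \<sigma> ` Y = Y"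
    using permute_plus_minus_orbit[OF \<sigma>] assms(7) by blast
  have len: "length J = length Q"
    using assms(5) by (simp add: subword_def list_all2_lengthD)
  have "permute_tuple (length Q) \<sigma> (bem_point id J) = (bem_point u J :: nat \<Rightarrow> 'n flag)"
    using permute_perm_flag[OF \<sigma> u] permutes_image[OF tail_perm_permutes[OF assms(5,4)]] assms(3)
    by (auto simp: permute_tuple_def bem_point_def len fun_eq_iff restrict_def)
  moreover have "vec.subspace (bem_point id J i d :: (complex ^ 'n::{finite,linorder}) set)"
    if "i \<in> {1..length Q + 1}" for i d
    using that by (simp add: bem_point_def len perm_flag_def)
  ultimately have "moment_map Q (bem_point u J :: nat \<Rightarrow> 'n flag) =
      permute_coords \<sigma> (moment_map Q (bem_point id J))"
    using moment_map_permute_tuple[OF \<sigma>] by metis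
  then show ?thesis
    using extreme_point_of_linear_symmetry[OF real_linear_permute_coords inj_permute_coords[OF \<sigma>]
        bem_polytope_permute_eq[OF \<sigma> Y]] by simp
qed

end
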